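(* Let $\boldsymbol X\sim P$ be a random vector in $\mathbb{R}^m$ such that the function $\boldsymbol x\mapsto\mathbb{P}(\|\boldsymbol X\|\ge\|\boldsymbol x\|)$ is integrable on $\mathbb{R}^m$ (with respect to Lebesgue measure). Then $\sigma_H(P)<\infty$ and $\sigma_\Delta(P)<\infty$.
   Context: For a distribution $P$ on $\mathbb{R}^m$: the halfspace depth is $d_H(\boldsymbol x,P)=\inf_{\boldsymbol u\in S^{m-1}}P(\{\boldsymbol y:\langle\boldsymbol u,\boldsymbol y\rangle\le\langle\boldsymbol u,\boldsymbol x\rangle\})$, with $S^{m-1}$ the unit sphere; the simplicial depth is $d_\Delta(\boldsymbol x,P)=\mathbb{P}(\boldsymbol x\in\Delta[\boldsymbol X_1,\dots,\boldsymbol X_{m+1}])$, with $\boldsymbol X_i$ i.i.d. with distribution $P$ and $\Delta[\cdot]$ the closed simplex (convex hull) with the given vertices. The dispersion measures are $\sigma_H(P)=\int_{\mathbb{R}^m}d_H(\boldsymbol x,P)\,d\boldsymbol x$ and $\sigma_\Delta(P)=\int_{\mathbb{R}^m}d_\Delta(\boldsymbol x,P)\,d\boldsymbol x$. $\|\cdot\|$ is the Euclidean norm. *)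

theory Defs
  imports "HOL-Probability.Probability"
begin

definition halfspace_depth :: "real ^ 'm \<Rightarrow> (real ^ 'm) measure \<Rightarrow> real" where
  "halfspace_depth x P = (INF u\<in>sphere 0 1. measure P {y. u \<bullet> y \<le> u \<bullet> x})"

text \<open>The i.i.d. sample of size \<open>m + 1\<close> is realised as the coordinates of the product measure.
  The event is measurable, see \<open>simplicial_event_measurable\<close> below.\<close>

definition simplicial_depth :: "real ^ 'm \<Rightarrow> (real ^ 'm) measure \<Rightarrow> real" where
  "simplicial_depth x P =
     measure (Pi\<^sub>M {1..CARD('m) + 1} (\<lambda>_. P))
       {\<omega> \<in> space (Pi\<^sub>M {1..CARD('m) + 1} (\<lambda>_. P)). x \<in> convex hull (\<omega> ` {1..CARD('m) + 1})}"

text \<open>Both integrands are nonnegative and Borel measurable (shown below), so the integrals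
  exist in \<open>[0, \<infinity>]\<close>.\<close>

definition sigma_H :: "(real ^ 'm) measure \<Rightarrow> ennreal" where
  "sigma_H P = (\<integral>\<^sup>+ x. ennreal (halfspace_depth x P) \<partial>lborel)"

definition sigma_Delta :: "(real ^ 'm) measure \<Rightarrow> ennreal" where
  "sigma_Delta P = (\<integral>\<^sup>+ x. ennreal (simplicial_depth x P) \<partial>lborel)"

lemma sphere_ne: "sphere (0 :: real ^ 'm) 1 \<noteq> {}"
  by simp

lemma halfspace_depth_nonneg: "0 \<le> halfspace_depth x P"
  unfolding halfspace_depth_def by (rule cINF_greatest[OF sphere_ne]) simp

lemma simplicial_depth_nonneg: "0 \<le> simplicial_depth x P"
  unfolding simplicial_depth_def by simp

lemma open_halfspace_measure_less:
  fixes P :: "(real ^ 'm) measure"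
  assumes "prob_space P" and sets: "sets P = sets borel"
  shows "open {x. measure P {y. u \<bullet> y \<le> u \<bullet> x} < c}"
proof -
  interpret prob_space P by fact
  have u: "(\<lambda>y. u \<bullet> y) \<in> borel_measurable P"
    by (subst measurable_cong_sets[OF sets refl]) simp
  define F where "F = cdf (distr P borel (\<lambda>y. u \<bullet> y))"
  interpret D: real_distribution "distr P borel (\<lambda>y. u \<bullet> y)"
    by (rule real_distribution_distr[OF u])
  have F: "F t = measure P {y. u \<bullet> y \<le> t}" for t
    unfolding F_def cdf_def using sets_eq_imp_space_eq[OF sets]
    by (subst measure_distr[OF u]) (auto intro!: arg_cong[where f="measure P"])
  have "open {t. F t < c}"
    unfolding open_dist
  proof safe
    fix t assume "F t < c"
    have "(F \<longlongrightarrow> F t) (at_right t)"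
      using D.cdf_is_right_cont unfolding F_def continuous_within by blast
    then have "eventually (\<lambda>s. F s < c) (at_right t)"
      using \<open>F t < c\<close> by (rule order_tendstoD)
    then obtain b where b: "b > t" "\<And>s. t < s \<Longrightarrow> s < b \<Longrightarrow> F s < c"
      unfolding eventually_at_right_field by blast
    have "F s < c" if "s < b" for s
    proof (cases "t < s")
      case False
      then have "F s \<le> F t" unfolding F_def by (intro D.cdf_nondecreasing) simp
      then show ?thesis using \<open>F t < c\<close> by simp
    qed (use b that in blast)
    then show "\<exists>e>0. \<forall>s. dist s t < e \<longrightarrow> s \<in> {t. F t < c}"
      using b(1) by (intro exI[of _ "b - t"]) (auto simp: dist_real_def)
  qed
  then have "open ((\<lambda>x. u \<bullet> x) -` {t. F t < c})"
    by (rule open_vimage) (intro continuous_intros)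
  then show ?thesis by (simp add: F vimage_def)
qed

lemma halfspace_depth_measurable:
  fixes P :: "(real ^ 'm) measure"
  assumes "prob_space P" "sets P = sets borel"
  shows "(\<lambda>x. halfspace_depth x P) \<in> borel_measurable borel"
proof (rule borel_measurableI_less)
  fix c
  have "{x. halfspace_depth x P < c}
      = (\<Union>u\<in>sphere 0 1. {x. measure P {y. u \<bullet> y \<le> u \<bullet> x} < c})"
    unfolding halfspace_depth_def
    by (subst cINF_less_iff[OF sphere_ne]) (auto intro!: bdd_belowI2[where m=0])
  moreover have "open \<dots>"
    by (intro open_UN ballI open_halfspace_measure_less assms)
  ultimately show "{x \<in> space borel. halfspace_depth x P < c} \<in> sets borel" by simp
qed

lemma in_convex_hull_iff_dense:
  fixes S D :: "'a :: euclidean_space set"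
  assumes "finite S" and D: "\<And>X. open X \<Longrightarrow> X \<noteq> {} \<Longrightarrow> \<exists>d\<in>D. d \<in> X"
  shows "x \<in> convex hull S \<longleftrightarrow> (\<forall>u\<in>D. \<exists>y\<in>S. u \<bullet> y \<le> u \<bullet> x)"
proof safe
  fix u assume x: "x \<in> convex hull S"
  show "\<exists>y\<in>S. u \<bullet> y \<le> u \<bullet> x"
  proof (rule ccontr)
    assume "\<not> ?thesis"
    then have "convex hull S \<subseteq> {y. u \<bullet> y > u \<bullet> x}"
      by (intro hull_minimal convex_halfspace_gt) (auto simp: not_le)
    with x show False by auto
  qed
next
  assume *: "\<forall>u\<in>D. \<exists>y\<in>S. u \<bullet> y \<le> u \<bullet> x"
  show "x \<in> convex hull S"
  proof (rule ccontr)
    assume "x \<notin> convex hull S"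
    then obtain a b where ab: "a \<bullet> x < b" "\<And>y. y \<in> convex hull S \<Longrightarrow> b < a \<bullet> y"
      using separating_hyperplane_closed_point[of "convex hull S" x] \<open>finite S\<close>
      by (auto simp: finite_imp_compact_convex_hull compact_imp_closed)
    define W where "W = (\<Inter>y\<in>S. {u. u \<bullet> x < u \<bullet> y})"
    have "open W" unfolding W_def using \<open>finite S\<close>
      by (intro open_INT ballI open_Collect_less continuous_intros)
    moreover have "a \<in> W" unfolding W_def
    proof safe
      fix y assume "y \<in> S"
      then show "a \<bullet> x < a \<bullet> y" using ab(1) ab(2)[OF hull_inc] by fastforce
    qed
    ultimately obtain d where "d \<in> D" "d \<in> W" using D by blast
    with * show False unfolding W_def by (force simp: not_le)
  qed
qed

lemma simplicial_event_joint_measurable: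
  fixes P :: "(real ^ 'm) measure"
  assumes "sets P = sets borel" "finite I"
  shows "{(x, \<omega>) \<in> space (borel \<Otimes>\<^sub>M Pi\<^sub>M I (\<lambda>_. P)). x \<in> convex hull (\<omega> ` I)}
           \<in> sets (borel \<Otimes>\<^sub>M Pi\<^sub>M I (\<lambda>_. P))"
proof -
  obtain D :: "(real ^ 'm) set" where D: "countable D"
    "\<And>X. open X \<Longrightarrow> X \<noteq> {} \<Longrightarrow> \<exists>d\<in>D. d \<in> X"
    using countable_dense_setE by blast
  let ?N = "(borel :: (real ^ 'm) measure) \<Otimes>\<^sub>M Pi\<^sub>M I (\<lambda>_. P)"
  have [measurable]: "(\<lambda>z. snd z i) \<in> borel_measurable ?N" if "i \<in> I" for i
  proof -
    have "(\<lambda>z. snd z i) \<in> measurable ?N P" using that by measurable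
    then show ?thesis by (subst (asm) measurable_cong_sets[OF refl assms(1)])
  qed
  have "{z \<in> space ?N. \<forall>u\<in>D. \<exists>i\<in>I. u \<bullet> snd z i \<le> u \<bullet> fst z} \<in> sets ?N"
  proof (intro sets.sets_Collect_countable_All'[OF _ \<open>countable D\<close>]
      sets.sets_Collect_finite_Ex[OF _ \<open>finite I\<close>])
    fix u i assume "i \<in> I"
    then show "{z \<in> space ?N. u \<bullet> snd z i \<le> u \<bullet> fst z} \<in> sets ?N" by measurable
  qed
  also have "{z \<in> space ?N. \<forall>u\<in>D. \<exists>i\<in>I. u \<bullet> snd z i \<le> u \<bullet> fst z}
     = {(x, \<omega>) \<in> space ?N. x \<in> convex hull (\<omega> ` I)}"
    using in_convex_hull_iff_dense[OF _ D(2)] \<open>finite I\<close> by auto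
  finally show ?thesis .
qed

lemma simplicial_event_measurable:
  fixes P :: "(real ^ 'm) measure"
  assumes "sets P = sets borel" "finite I"
  shows "{\<omega> \<in> space (Pi\<^sub>M I (\<lambda>_. P)). x \<in> convex hull (\<omega> ` I)} \<in> sets (Pi\<^sub>M I (\<lambda>_. P))"
  using sets_Pair1[OF simplicial_event_joint_measurable[OF assms], of x]
  by (simp add: vimage_def space_pair_measure)

lemma simplicial_depth_measurable:
  fixes P :: "(real ^ 'm) measure"
  assumes "prob_space P" and sets: "sets P = sets borel"
  shows "(\<lambda>x. simplicial_depth x P) \<in> borel_measurable borel"
proof -
  let ?I = "{1..CARD('m) + 1}"
  interpret N: prob_space "Pi\<^sub>M ?I (\<lambda>_. P)"
    by (rule prob_space_PiM) (rule assms(1))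
  have "(\<lambda>x. emeasure (Pi\<^sub>M ?I (\<lambda>_. P)) (Pair x -`
      {(x, \<omega>) \<in> space (borel \<Otimes>\<^sub>M Pi\<^sub>M ?I (\<lambda>_. P)). x \<in> convex hull (\<omega> ` ?I)}))
      \<in> borel_measurable borel"
    by (rule N.measurable_emeasure_Pair[OF simplicial_event_joint_measurable[OF sets]]) simp
  from borel_measurable_enn2real[OF this]
  show ?thesis
    by (simp add: simplicial_depth_def measure_def vimage_def space_pair_measure)
qed

end

theory Submission
  imports Defs
begin

text \<open>Both depths at \<open>x\<close> are dominated by a constant times the tail
  \<open>measure P {y. norm y \<ge> norm x}\<close>, which is integrable in \<open>x\<close> by
  hypothesis, so both dispersions are finite by comparison. For the halfspace depth
  (\<open>halfspace_depth_le_norm_tail\<close>, constant 1), one halfspace suffices: the one bounded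
  by the tangent hyperplane at \<open>x\<close> to the sphere of radius \<open>norm x\<close>, on
  the side away from the origin, which misses the open ball. For the simplicial depth
  (\<open>simplicial_depth_le_norm_tail\<close>, constant m + 1), a simplex containing
  \<open>x\<close> must have a vertex outside that ball, and a union bound over the m + 1 vertices
  applies.\<close>

lemma halfspace_depth_le_norm_tail:
  fixes P :: "(real ^ 'm) measure"
  assumes "prob_space P" and sets: "sets P = sets borel"
  shows "halfspace_depth x P \<le> measure P {y. norm y \<ge> norm x}"
proof -
  interpret prob_space P by fact
  have le: "halfspace_depth x P \<le> measure P {y. u \<bullet> y \<le> u \<bullet> x}" if "norm u = 1" for u
    unfolding halfspace_depth_def
    using that by (intro cINF_lower bdd_belowI2[where m=0]) auto
  show ?thesis
  \<comment> \<open>The origin is separate because \<open>sgn 0 = 0\<close> is not a unit vector;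
    there the tail equals 1, so the trivial bound is enough.\<close>
  proof (cases "x = 0")
    case True
    obtain u :: "real ^ 'm" where "norm u = 1"
      using vector_choose_size[of 1] by auto
    from le[OF this] have "halfspace_depth x P \<le> 1"
      using prob_le_1 by (rule order_trans)
    also have "1 = measure P {y. norm y \<ge> norm x}"
      using True prob_space sets_eq_imp_space_eq[OF sets] by simp
    finally show ?thesis .
  next
    case False
    \<comment> \<open>The witness for the infimum is the unit vector pointing from \<open>x\<close>
      to the origin. By Cauchy-Schwarz, its halfspace through \<open>x\<close> avoids the open ball
      of radius \<open>norm x\<close>.\<close>
    have "norm x \<le> norm y" if "- sgn x \<bullet> y \<le> - sgn x \<bullet> x" for y
    proof -
      have "norm x = sgn x \<bullet> x"
        using False by (simp add: sgn_div_norm norm_eq_sqrt_inner real_div_sqrt divide_inverse_commute[symmetric])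
      also have "\<dots> \<le> sgn x \<bullet> y" using that by simp
      also have "\<dots> \<le> norm (sgn x) * norm y" by (rule norm_cauchy_schwarz)
      finally show ?thesis using False by (simp add: norm_sgn)
    qed
    then have "measure P {y. - sgn x \<bullet> y \<le> - sgn x \<bullet> x} \<le> measure P {y. norm y \<ge> norm x}"
      by (intro finite_measure_mono) (auto simp: sets)
    then show ?thesis
      using le[of "- sgn x"] False by (simp add: norm_sgn)
  qed
qed

text \<open>The open ball of radius \<open>norm x\<close> is convex and excludes \<open>x\<close>,
  so the vertices of a simplex through \<open>x\<close> cannot all lie in it. The factor is the
  number of vertices.\<close>

lemma simplicial_depth_le_norm_tail:
  fixes P :: "(real ^ 'm) measure"
  assumes "prob_space P" and sets: "sets P = sets borel"
  shows "simplicial_depth x P \<le> real (CARD('m) + 1) * measure P {y. norm y \<ge> norm x}"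
proof -
  interpret prob_space P by fact
  define I where "I = {1..CARD('m) + 1}"
  define N where "N = Pi\<^sub>M I (\<lambda>_. P)"
  interpret N: product_prob_space "\<lambda>_. P" I by unfold_locales
  interpret PN: prob_space N unfolding N_def by (rule prob_space_PiM) (rule assms(1))
  define T where "T = {y :: real ^ 'm. norm y \<ge> norm x}"
  define A where "A i = {\<omega> \<in> space N. \<omega> i \<in> T}" for i
  have T: "T \<in> sets P" unfolding T_def sets by measurable
  \<comment> \<open>Each coordinate of the product measure has law \<open>P\<close>.\<close>
  have A: "A i \<in> sets N" "measure N (A i) = measure P T" if "i \<in> I" for i
    using N.emeasure_PiM_Collect_single[OF that T] that T
    unfolding A_def N_def measure_def by auto
  have "{\<omega> \<in> space N. x \<in> convex hull (\<omega> ` I)} \<subseteq> (\<Union>i\<in>I. A i)"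
  proof safe
    fix \<omega> assume w: "\<omega> \<in> space N" "x \<in> convex hull (\<omega> ` I)"
    have "\<not> \<omega> ` I \<subseteq> ball 0 (norm x)"
      using hull_minimal[where S=convex, of "\<omega> ` I" "ball 0 (norm x)"] w(2)
      by (metis convex_ball dist_0_norm less_irrefl mem_ball subsetD)
    then show "\<omega> \<in> (\<Union>i\<in>I. A i)"
      using w(1) by (auto simp: A_def T_def not_less)
  qed
  then have "measure N {\<omega> \<in> space N. x \<in> convex hull (\<omega> ` I)} \<le> measure N (\<Union>i\<in>I. A i)"
    by (intro PN.finite_measure_mono sets.finite_UN A) (auto simp: I_def)
  \<comment> \<open>Subadditivity alone gives the bound; independence of the vertices does not
    enter.\<close>
  also have "\<dots> \<le> (\<Sum>i\<in>I. measure N (A i))"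
    by (intro PN.finite_measure_subadditive_finite) (auto simp: I_def intro: A)
  also have "\<dots> = real (CARD('m) + 1) * measure P T"
    by (simp add: A) (simp add: I_def)
  finally show ?thesis
    unfolding simplicial_depth_def N_def I_def T_def .
qed

theorem proposition8:
  fixes M :: "'w measure" and X :: "'w \<Rightarrow> real ^ 'm" and P :: "(real ^ 'm) measure"
  assumes "prob_space M"
    and "X \<in> borel_measurable M"
    and "P = distr M borel X"
    and "integrable lborel (\<lambda>x :: real ^ 'm. measure M {w \<in> space M. norm (X w) \<ge> norm x})"
  shows "sigma_H P < \<infinity> \<and> sigma_Delta P < \<infinity>"
proof -
  have P: "prob_space P" "sets P = sets borel"
    using assms by (auto intro: prob_space.prob_space_distr)
  have tail: "measure P {y. norm y \<ge> norm x} = measure M {w \<in> space M. norm (X w) \<ge> norm x}"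
    for x :: "real ^ 'm"
    unfolding assms(3)
    by (subst measure_distr[OF assms(2)]) (auto intro!: arg_cong[where f="measure M"])
  \<comment> \<open>Comparison principle serving both depths, with \<open>c\<close> equal to 1 and
    to m + 1. The majorant is passed through \<open>norm\<close>, the form in which integrability
    yields a finite nonnegative integral.\<close>
  have finite: "(\<integral>\<^sup>+ x. ennreal (f x) \<partial>lborel) < \<infinity>"
    if "\<And>x. f x \<le> c * measure P {y. norm y \<ge> norm x}" for f :: "real ^ 'm \<Rightarrow> real" and c
  proof -
    have "integrable lborel (\<lambda>x :: real ^ 'm. c * measure P {y. norm y \<ge> norm x})"
      unfolding tail using assms(4) by simp
    then have "(\<integral>\<^sup>+ x. norm (c * measure P {y. norm y \<ge> norm (x :: real ^ 'm)}) \<partial>lborel) < \<infinity>"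
      unfolding integrable_iff_bounded by blast
    moreover have "(\<integral>\<^sup>+ x. ennreal (f x) \<partial>lborel)
        \<le> (\<integral>\<^sup>+ x. norm (c * measure P {y. norm y \<ge> norm (x :: real ^ 'm)}) \<partial>lborel)"
      using that by (intro nn_integral_mono ennreal_leI) (metis abs_ge_self order_trans real_norm_def)
    ultimately show ?thesis by (rule le_less_trans[rotated])
  qed
  show ?thesis
    unfolding sigma_H_def sigma_Delta_def
    using finite[of "\<lambda>x. halfspace_depth x P" 1] halfspace_depth_le_norm_tail[OF P]
      finite[OF simplicial_depth_le_norm_tail[OF P]]
    by simp
qed

end
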